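(* Let $p,q\in(1,\infty)$ with $\frac1p+\frac1q=1$, let $X$ be a $p$-convex and $q$-smooth Banach space, let $Y$ be a Banach space, and let $F:\mathcal{D}(F)\subset X\to Y$ be continuous and locally Fréchet differentiable. Let $Z\subset\mathcal{D}(F)$ be a closed convex subset of $X$, let $y\in Y$, and let $z^\dagger\in Z$ satisfy $\|F(z^\dagger)-y\|=\operatorname{dist}(y,F(Z))$. Let $\mathfrak{L},\hat{\mathfrak{L}},\mathfrak{C}>0$ be constants and put $$\tilde{\mathfrak{C}}:=\frac12\Big(\frac{C_p}{p}\Big)^{-2/p}\mathfrak{L}\,\mathfrak{C}^2 .$$ Assume that $\operatorname{dist}(y,F(Z))\le\eta$ for some $\eta\in\big(0,(8\tilde{\mathfrak{C}})^{-1}\big)$, let $\hat\eta>3\eta$, and put $$\rho:=\frac{C_p}{p}\,(2\tilde{\mathfrak{C}}\hat{\mathfrak{L}})^{-p}\Big(1+\sqrt{1-8\tilde{\mathfrak{C}}\eta}-4\eta\tilde{\mathfrak{C}}\Big)^p,\qquad \mathcal{B}:=\{x\in X:\Delta_p(x,z^\dagger)\le\rho\}.$$ Assume $\mathcal{B}\subset\mathcal{D}(F)$ and: (a) $\|DF(x)\|\le\hat{\mathfrak{L}}$ and $\|DF(x)-DF(\tilde x)\|\le\mathfrak{L}\|x-\tilde x\|$ for all $x,\tilde x\in\mathcal{B}$; (b) $F$ is weakly sequentially closed, i.e. if $x_n\rightharpoonup x$ weakly in $X$ and $F(x_n)\to \bar y$ in $Y$, then $x\in\mathcal{D}(F)$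 and $F(x)=\bar y$; (c) $\Delta_p(x,\tilde x)\le\mathfrak{C}^p\|F(x)-F(\tilde x)\|^p$ for all $x,\tilde x\in\mathcal{B}\cap Z$. Let $x_0\in Z$ satisfy $\Delta_p(x_0,z^\dagger)<\rho$, and consider the projected steepest descent algorithm described in the context, started at $x_0$. Then the algorithm stops after a finite number $K=K(\eta)$ of iterations, with the discrepancy criterion $$r_K=\|F(x_K)-y\|\le\hat\eta$$ being satisfied, and for all $k\le K(\eta)-1$ the Bregman distance is strictly monotone in the sense that $$\Delta_p(x_{k+1},z^\dagger)\le\Delta_p(x_k,z^\dagger)+w_k\,\Delta_p(x_k,z^\dagger)^{2/p}-v_k$$ with $$w_k\,\Delta_p(x_k,z^\dagger)^{2/p}-v_k<0 .$$
   Context: Geometry of Banach spaces. The convexity modulus of $X$ is $\delta_X(\epsilon)=\inf\{1-\|\frac12(x+\tilde x)\| : \|x\|=\|\tilde x\|=1,\ \|x-\tilde x\|\ge\epsilon\}$ and the smoothness modulus is $\rho_X(\tau)=\sup\{\frac12(\|x+\tau\tilde x\|+\|x-\tau\tilde x\|-2):\|x\|=\|\tilde x\|=1\}$. $X$ is $p$-convex if there is $C>0$ with $\delta_X(\epsilon)\ge C\epsilon^p$, and $q$-smooth if there is $C>0$ with $\rho_X(\tau)\le C\tau^q$. Under the present assumptions $X$ is uniformly convex, uniformly smooth and reflexive. Duality mappings. $J_p:X\to X^*$ is the duality mapping with gauge function $t\mapsto t^{p-1}$, i.e. $J_p(x)$ is the (here unique) $x^*\in X^*$ with $\langle x,x^*\rangle=\|x\|\,\|x^*\|$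 and $\|x^*\|=\|x\|^{p-1}$. It is bijective, with inverse $J_q^*:X^*\to X$, the duality mapping of $X^*$ with gauge function $t\mapsto t^{q-1}$. $j_p:Y\to Y^*$ is a fixed single-valued selection of the (possibly set-valued) duality mapping of $Y$ with gauge function $t\mapsto t^{p-1}$. Bregman distance. $\Delta_p(x,\tilde x)=\frac1p\|\tilde x\|^p-\frac1p\|x\|^p-\langle J_p(x),\tilde x-x\rangle$ for $x,\tilde x\in X$; $\Delta_q$ denotes the analogous quantity on $X^*$ (with $J_q^*$). $C_p>0$ is a constant such that $\Delta_p(x,\tilde x)\ge\frac{C_p}{p}\|x-\tilde x\|^p$ for all $x,\tilde x\in X$, and $G_q>0$ is a constant such that $\Delta_q(x^*,\tilde x^* )\le\frac{G_q}{q}\|x^*-\tilde x^*\|^q$ for all $x^*,\tilde x^*\in X^*$ (such constants exist since $X$ is $p$-convex and $X^*$ is $q$-smooth). Bregman projection. For $Z\subset X$ closed and convex, $P_Z(x)$ is the minimizer of $z\mapsto\Delta_p(x,z)$ over $z\in Z$; it is well defined. Notation. $DF(x)\in\mathcal{L}(X,Y)$ is the Fréchet derivative of $F$ at $x$, and $DF(x)^*\in\mathcal{L}(Y^*,X^* )$ its dual operator. The algorithm. Starting from $x_0$, for $k=0,1,2,\dots$ put $$R_k=F(x_k)-y,\quad T_k=DF(x_k)^*j_p(F(x_k)-y),\quad r_k=\|R_k\|,\quad t_k=\|T_k\|,$$ $$\hat t_k=G_qt_k^q,\qquad u_k=-\tilde{\mathfrak{C}}r_k^2+(1-2\tilde{\mathfrak{C}}\eta)r_k-\eta-\tilde{\mathfrak{C}}\eta^2,$$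 $$v_k=\hat t_k^{-\frac1{q-1}}u_k^{\frac1{q-1}}r_k^{p^2-p}(r_k-\eta)-\frac1q\hat t_k^{-\frac1{q-1}}u_k^{p}r_k^{p^2-p},$$ $$w_k=\frac{\mathfrak{L}}2\Big(\frac{C_p}p\Big)^{-2/p}\hat t_k^{-\frac1{q-1}}u_k^{\frac1{q-1}}r_k^{p^2-p},\qquad \mu_k=\hat t_k^{-\frac1{q-1}}u_k^{\frac1{q-1}}r_k^{\frac{p-1}{q-1}}.$$ As long as the discrepancy criterion $r_k\le\hat\eta$ is not satisfied, the next iterate is $$\tilde x_{k+1}=J_q^*\big(J_p(x_k)-\mu_kT_k\big),\qquad x_{k+1}=P_Z(\tilde x_{k+1}).$$ The algorithm stops at the index $K(\eta)=\min\{k\in\mathbb{N}:\|F(x_k)-y\|\le\hat\eta\}$, where $0\in\mathbb{N}$. *)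

theory Defs
  imports "HOL-Analysis.Analysis"
begin

text \<open>
  The moduli are extended-real valued, so that the conventions inf of the empty set = \<open>\<infinity>\<close> and
  sup of the empty set = \<open>-\<infinity>\<close> apply (there are no unit vectors in the zero space).
\<close>

definition convexity_modulus :: "'a::real_normed_vector itself \<Rightarrow> real \<Rightarrow> ereal" where
  "convexity_modulus _ \<epsilon> =
     (INF (x, x') \<in> {(x::'a, x'::'a). norm x = 1 \<and> norm x' = 1 \<and> norm (x - x') \<ge> \<epsilon>}.
        ereal (1 - norm ((1/2) *\<^sub>R (x + x'))))"

definition smoothness_modulus :: "'a::real_normed_vector itself \<Rightarrow> real \<Rightarrow> ereal" where
  "smoothness_modulus _ \<tau> =
     (SUP (x, x') \<in> {(x::'a, x'::'a). norm x = 1 \<and> norm x' = 1}.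
        ereal ((1/2) * (norm (x + \<tau> *\<^sub>R x') + norm (x - \<tau> *\<^sub>R x') - 2)))"

definition p_convex :: "'a::real_normed_vector itself \<Rightarrow> real \<Rightarrow> bool" where
  "p_convex X p \<longleftrightarrow>
     (\<exists>C>0. \<forall>\<epsilon>. 0 < \<epsilon> \<and> \<epsilon> \<le> 2 \<longrightarrow> convexity_modulus X \<epsilon> \<ge> ereal (C * \<epsilon> powr p))"

definition q_smooth :: "'a::real_normed_vector itself \<Rightarrow> real \<Rightarrow> bool" where
  "q_smooth X q \<longleftrightarrow> (\<exists>C>0. \<forall>\<tau>>0. smoothness_modulus X \<tau> \<le> ereal (C * \<tau> powr q))"

text \<open>The set-valued duality mapping with gauge function \<open>t \<mapsto> t\<close> to the power \<open>s - 1\<close>.\<close>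

definition duality_mapping ::
    "real \<Rightarrow> 'a::real_normed_vector \<Rightarrow> ('a \<Rightarrow>\<^sub>L real) set" where
  "duality_mapping s x = {f. blinfun_apply f x = norm x * norm f \<and> norm f = norm x powr (s - 1)}"

definition J :: "real \<Rightarrow> 'a::real_normed_vector \<Rightarrow> ('a \<Rightarrow>\<^sub>L real)" where
  "J p x = (THE f. f \<in> duality_mapping p x)"

lift_definition bidual_embedding ::
    "'a::real_normed_vector \<Rightarrow> ('a \<Rightarrow>\<^sub>L real) \<Rightarrow>\<^sub>L real" is
  "\<lambda>x f. blinfun_apply f x"
  by (rule bounded_linear_intros) (rule bounded_linear_ident)

text \<open>
  The duality mapping of the dual space takes values in the bidual; for reflexive \<open>'a\<close> these
  are identified with elements of \<open>'a\<close> along the canonical embedding.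
\<close>

definition J_dual :: "real \<Rightarrow> ('a::real_normed_vector \<Rightarrow>\<^sub>L real) \<Rightarrow> 'a" where
  "J_dual q f = (THE x. bidual_embedding x \<in> duality_mapping q f)"

definition bregman :: "real \<Rightarrow> 'a::real_normed_vector \<Rightarrow> 'a \<Rightarrow> real" where
  "bregman p x x' =
     (1/p) * norm x' powr p - (1/p) * norm x powr p - blinfun_apply (J p x) (x' - x)"

definition bregman_dual ::
    "real \<Rightarrow> ('a::real_normed_vector \<Rightarrow>\<^sub>L real) \<Rightarrow> ('a \<Rightarrow>\<^sub>L real) \<Rightarrow> real" where
  "bregman_dual q f g =
     (1/q) * norm g powr q - (1/q) * norm f powr q - blinfun_apply (g - f) (J_dual q f)"

definition bregman_proj :: "real \<Rightarrow> 'a::real_normed_vector set \<Rightarrow> 'a \<Rightarrow> 'a" where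
  "bregman_proj p Z x = arg_min_on (bregman p x) Z"

lift_definition dual_operator ::
    "('a::real_normed_vector \<Rightarrow>\<^sub>L 'b::real_normed_vector) \<Rightarrow> ('b \<Rightarrow>\<^sub>L real) \<Rightarrow>\<^sub>L ('a \<Rightarrow>\<^sub>L real)" is
  "\<lambda>A f. f o\<^sub>L A"
  by (rule bounded_bilinear.bounded_linear_left[OF bounded_bilinear_blinfun_compose])

definition weakly_tendsto :: "(nat \<Rightarrow> 'a::real_normed_vector) \<Rightarrow> 'a \<Rightarrow> bool" where
  "weakly_tendsto s l \<longleftrightarrow>
     (\<forall>f :: 'a \<Rightarrow>\<^sub>L real. (\<lambda>n. blinfun_apply f (s n)) \<longlonglongrightarrow> blinfun_apply f l)"

definition weakly_seq_closed_on ::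
    "'a::real_normed_vector set \<Rightarrow> ('a \<Rightarrow> 'b::real_normed_vector) \<Rightarrow> bool" where
  "weakly_seq_closed_on D F \<longleftrightarrow>
     (\<forall>s l m. (\<forall>n. s n \<in> D) \<and> weakly_tendsto s l \<and> (\<lambda>n. F (s n)) \<longlonglongrightarrow> m
        \<longrightarrow> l \<in> D \<and> F l = m)"

end

theory Submission
  imports Defs
begin

text \<open>
  Let \<open>z\<close> be the reference solution. The proof shows that the Bregman distance of the iterates to \<open>z\<close>
  drops by at least a fixed positive amount in every iteration in which the discrepancy criterion
  fails. As the distance is nonnegative, this can happen only finitely often.

  In one iteration, the projection does not increase the distance to \<open>z\<close> (\<open>bregman_proj_le\<close>), and
  the step in the dual space changes it by a first-order term plus a remainder controlled by the
  smoothness of the dual (\<open>bregman_dual_step\<close>). The first-order term is negative as long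
  as the linearization error of \<open>F\<close> between the iterate and \<open>z\<close> is smaller than the residual minus
  the noise level. That error is quadratic in the distance to \<open>z\<close>, and conditional
  stability bounds the distance by the residual, so that a quadratic polynomial in the residual
  decides. It is positive between its two roots: the lower root is excluded by the failure
  of the discrepancy criterion, the upper root by the radius of the ball, and both with a margin that
  is uniform along the iteration (\<open>discrepancy_quadratic_lower_bound\<close>). The choice of the step size
  then leaves the fraction \<open>1 / p\<close> of the first-order gain (\<open>steepest_descent_step\<close>), and the
  bound on the derivative of \<open>F\<close> makes this gain uniform as well (\<open>step_gain_lower_bound\<close>).

  Two points of the geometry of the space are less routine. The duality mapping and its inverse are
  defined by description operators, so existence and uniqueness have to be established. Smoothness
  yields the duality mapping as the derivative of the norm, and convexity yields its surjectivity, as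
  well as the Bregman projections, by minimizing \<open>\<parallel>x\<parallel> powr p / p\<close> minus a linear functional
  (\<open>energy_minimizer_exists\<close>).
  Moreover, Bregman balls need not be convex, but they are star-shaped about their centre
  (\<open>bregman_star_shaped\<close>), which is all that the Taylor estimate requires.
\<close>

section \<open>The derivative of the norm in a smooth space\<close>

lemma norm_slope_mono:
  fixes x h :: "'a::real_normed_vector"
  assumes "0 < s" "s \<le> t"
  shows "(norm (x + s *\<^sub>R h) - norm x) / s \<le> (norm (x + t *\<^sub>R h) - norm x) / t"
proof -
  have "x + s *\<^sub>R h = (1 - s/t) *\<^sub>R x + (s/t) *\<^sub>R (x + t *\<^sub>R h)"
    using assms by (simp add: algebra_simps)
  then have "norm (x + s *\<^sub>R h) \<le> norm ((1 - s/t) *\<^sub>R x) + norm ((s/t) *\<^sub>R (x + t *\<^sub>R h))"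
    by (metis norm_triangle_ineq)
  also have "\<dots> = (1 - s/t) * norm x + (s/t) * norm (x + t *\<^sub>R h)"
    using assms by simp
  finally show ?thesis
    using assms by (simp add: field_simps)
qed

lemma norm_slope_bound:
  fixes x h :: "'a::real_normed_vector"
  assumes "0 < t"
  shows "\<bar>(norm (x + t *\<^sub>R h) - norm x) / t\<bar> \<le> norm h"
proof -
  have "\<bar>norm (x + t *\<^sub>R h) - norm x\<bar> \<le> norm (t *\<^sub>R h)"
    by (metis add_diff_cancel_left' norm_triangle_ineq3)
  then show ?thesis using assms by (simp add: field_simps)
qed

text \<open>
  The slopes \<open>(\<parallel>x + t h\<parallel> - \<parallel>x\<parallel>) / t\<close> increase with \<open>t\<close>, because the norm is convex, so their
  infimum over \<open>t > 0\<close> is the right-hand directional derivative of the norm at \<open>x\<close>.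
\<close>

definition norm_dir :: "'a::real_normed_vector \<Rightarrow> 'a \<Rightarrow> real" where
  "norm_dir x h = (INF t\<in>{0<..}. (norm (x + t *\<^sub>R h) - norm x) / t)"

lemma bdd_below_norm_slopes:
  fixes x h :: "'a::real_normed_vector"
  shows "bdd_below ((\<lambda>t. (norm (x + t *\<^sub>R h) - norm x) / t) ` {0<..})"
proof (rule bdd_belowI2)
  fix t :: real assume "t \<in> {0<..}"
  then show "- norm h \<le> (norm (x + t *\<^sub>R h) - norm x) / t"
    using norm_slope_bound[of t x h, unfolded abs_le_iff] by auto
qed

lemma norm_dir_le_slope:
  assumes "0 < t"
  shows "norm_dir x h \<le> (norm (x + t *\<^sub>R h) - norm x) / t"
  unfolding norm_dir_def using assms by (intro cINF_lower bdd_below_norm_slopes) auto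

lemma norm_dir_tendsto:
  "((\<lambda>t. (norm (x + t *\<^sub>R h) - norm x) / t) \<longlongrightarrow> norm_dir x h) (at_right 0)"
proof (rule order_tendstoI)
  fix a assume "a < norm_dir x h"
  then show "\<forall>\<^sub>F t in at_right 0. a < (norm (x + t *\<^sub>R h) - norm x) / t"
    using norm_dir_le_slope[of _ x h] less_le_trans
    by (auto simp: eventually_at_right_field intro!: exI[of _ 1])
next
  fix a assume "norm_dir x h < a"
  then obtain t where t: "t > 0" "(norm (x + t *\<^sub>R h) - norm x) / t < a"
    unfolding norm_dir_def using cINF_less_iff[OF _ bdd_below_norm_slopes, of x h a] by auto
  then show "\<forall>\<^sub>F t in at_right 0. (norm (x + t *\<^sub>R h) - norm x) / t < a"
    using norm_slope_mono[of _ t x h] by (force simp: eventually_at_right_field intro!: exI[of _ t])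
qed

lemma norm_dir_unique:
  assumes "((\<lambda>t. (norm (x + t *\<^sub>R h) - norm x) / t) \<longlongrightarrow> l) (at_right 0)"
  shows "norm_dir x h = l"
  using tendsto_unique[OF _ norm_dir_tendsto assms] by simp

lemma norm_dir_abs_le: "\<bar>norm_dir x h\<bar> \<le> norm h"
proof (rule tendsto_upperbound[OF tendsto_rabs[OF norm_dir_tendsto]])
  show "\<forall>\<^sub>F t in at_right 0. \<bar>(norm (x + t *\<^sub>R h) - norm x) / t\<bar> \<le> norm h"
    using norm_slope_bound by (auto simp: eventually_at_right_field intro!: exI[of _ 1])
qed simp

lemma norm_dir_self: "norm_dir x x = norm x"
proof (rule norm_dir_unique)
  have "\<forall>\<^sub>F t in at_right 0. norm x = (norm (x + t *\<^sub>R x) - norm x) / t"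
  proof (rule eventually_at_rightI[of 0 1])
    fix t :: real assume "t \<in> {0<..<1}"
    moreover have "x + t *\<^sub>R x = (1 + t) *\<^sub>R x" by (simp add: algebra_simps)
    then have "norm (x + t *\<^sub>R x) = \<bar>1 + t\<bar> * norm x" by (simp only: norm_scaleR)
    ultimately show "norm x = (norm (x + t *\<^sub>R x) - norm x) / t"
      by (simp add: field_simps)
  qed simp
  then show "((\<lambda>t. (norm (x + t *\<^sub>R x) - norm x) / t) \<longlongrightarrow> norm x) (at_right 0)"
    by (rule Lim_transform_eventually[OF tendsto_const])
qed

lemma norm_dir_scale:
  assumes "0 < c"
  shows "norm_dir x (c *\<^sub>R h) = c * norm_dir x h"
proof (rule norm_dir_unique)
  have "filterlim (\<lambda>t::real. c * t) (at_right 0) (at_right 0)"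
    using filterlim_times_pos[OF filterlim_ident assms, of 0 0] by simp
  from filterlim_compose[OF norm_dir_tendsto this, of x h]
  have "((\<lambda>t. c * ((norm (x + (c * t) *\<^sub>R h) - norm x) / (c * t))) \<longlongrightarrow> c * norm_dir x h) (at_right 0)"
    by (rule tendsto_mult_left)
  then show "((\<lambda>t. (norm (x + t *\<^sub>R c *\<^sub>R h) - norm x) / t) \<longlongrightarrow> c * norm_dir x h) (at_right 0)"
    using assms by (simp add: mult.commute)
qed

text \<open>
  Convexity of the norm makes its directional derivative sublinear: \<open>x + t (h + k)\<close> is the midpoint
  of \<open>x + 2 t h\<close> and \<open>x + 2 t k\<close>.
\<close>

lemma norm_dir_add_le: "norm_dir x (h + k) \<le> norm_dir x h + norm_dir x k"
proof (rule tendsto_le[OF _ _ norm_dir_tendsto])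
  have eq: "norm_dir x h + norm_dir x k = (norm_dir x (2 *\<^sub>R h) + norm_dir x (2 *\<^sub>R k)) / 2"
    by (simp add: norm_dir_scale)
  show "((\<lambda>t. ((norm (x + t *\<^sub>R (2 *\<^sub>R h)) - norm x) / t + (norm (x + t *\<^sub>R (2 *\<^sub>R k)) - norm x) / t) / 2)
           \<longlongrightarrow> norm_dir x h + norm_dir x k) (at_right 0)"
    unfolding eq by (intro tendsto_intros norm_dir_tendsto) simp
  show "\<forall>\<^sub>F t in at_right 0. (norm (x + t *\<^sub>R (h + k)) - norm x) / t
      \<le> ((norm (x + t *\<^sub>R (2 *\<^sub>R h)) - norm x) / t + (norm (x + t *\<^sub>R (2 *\<^sub>R k)) - norm x) / t) / 2"
  proof (rule eventually_at_rightI[of 0 1])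
    fix t :: real assume t: "t \<in> {0<..<1}"
    have "2 *\<^sub>R (x + t *\<^sub>R (h + k)) = (x + t *\<^sub>R (2 *\<^sub>R h)) + (x + t *\<^sub>R (2 *\<^sub>R k))"
      by (simp add: algebra_simps flip: scaleR_2)
    then have "2 * norm (x + t *\<^sub>R (h + k)) \<le> norm (x + t *\<^sub>R (2 *\<^sub>R h)) + norm (x + t *\<^sub>R (2 *\<^sub>R k))"
      using norm_triangle_ineq[of "x + t *\<^sub>R (2 *\<^sub>R h)" "x + t *\<^sub>R (2 *\<^sub>R k)"]
      by (metis abs_numeral norm_scaleR)
    then have "norm (x + t *\<^sub>R (h + k)) - norm x
      \<le> ((norm (x + t *\<^sub>R (2 *\<^sub>R h)) - norm x) + (norm (x + t *\<^sub>R (2 *\<^sub>R k)) - norm x)) / 2"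
      by argo
    from divide_right_mono[OF this, of t] t
    show "(norm (x + t *\<^sub>R (h + k)) - norm x) / t
      \<le> ((norm (x + t *\<^sub>R (2 *\<^sub>R h)) - norm x) / t + (norm (x + t *\<^sub>R (2 *\<^sub>R k)) - norm x) / t) / 2"
      by (simp only: add_divide_distrib divide_divide_eq_left mult.commute[of 2]) simp
  qed simp
qed simp

text \<open>
  Homogeneity turns the smoothness modulus, which only sees unit vectors, into a bound at any
  nonzero base point: with \<open>\<parallel>x\<parallel>\<close> factored out, a step \<open>t h\<close> from \<open>x\<close> is a step of length
  \<open>t \<parallel>h\<parallel> / \<parallel>x\<parallel>\<close> from a unit vector.
\<close>

lemma q_smooth_norm_bound:
  fixes x h :: "'a::real_normed_vector"
  assumes "q_smooth TYPE('a) q" "x \<noteq> 0"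
  obtains K where "\<And>t. t > 0 \<Longrightarrow> norm (x + t *\<^sub>R h) + norm (x - t *\<^sub>R h) - 2 * norm x \<le> K * t powr q"
proof (cases "h = 0")
  case True
  then show ?thesis using that[of 0] by simp
next
  case False
  obtain C where C: "\<And>t. t > 0 \<Longrightarrow> smoothness_modulus TYPE('a) t \<le> ereal (C * t powr q)"
    using assms(1) unfolding q_smooth_def by blast
  define a b where "a = norm x" and "b = norm h"
  have ab: "a > 0" "b > 0" using assms(2) False by (auto simp: a_def b_def)
  have "norm (x + t *\<^sub>R h) + norm (x - t *\<^sub>R h) - 2 * norm x \<le> (2 * a * C * (b / a) powr q) * t powr q"
    if t: "t > 0" for t
  proof -
    define s where "s = t * b / a"
    have s: "s > 0" using t ab by (simp add: s_def)
    define x1 h1 where "x1 = (1 / a) *\<^sub>R x" and "h1 = (1 / b) *\<^sub>R h"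
    have unit: "norm x1 = 1" "norm h1 = 1" using ab by (simp_all add: x1_def h1_def a_def b_def)
    have "ereal ((1/2) * (norm (x1 + s *\<^sub>R h1) + norm (x1 - s *\<^sub>R h1) - 2)) \<le> smoothness_modulus TYPE('a) s"
      unfolding smoothness_modulus_def
      by (rule SUP_upper2[of "(x1, h1)"]) (use unit in auto)
    also have "\<dots> \<le> ereal (C * s powr q)" by (rule C[OF s])
    finally have *: "norm (x1 + s *\<^sub>R h1) + norm (x1 - s *\<^sub>R h1) - 2 \<le> 2 * C * s powr q" by simp
    have "x + t *\<^sub>R h = a *\<^sub>R (x1 + s *\<^sub>R h1)" "x - t *\<^sub>R h = a *\<^sub>R (x1 - s *\<^sub>R h1)"
      using ab by (simp_all add: x1_def h1_def s_def algebra_simps)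
    then have "norm (x + t *\<^sub>R h) = a * norm (x1 + s *\<^sub>R h1)" "norm (x - t *\<^sub>R h) = a * norm (x1 - s *\<^sub>R h1)"
      using ab(1) by (simp_all only: norm_scaleR abs_of_pos)
    then have "norm (x + t *\<^sub>R h) + norm (x - t *\<^sub>R h) - 2 * norm x
        = a * (norm (x1 + s *\<^sub>R h1) + norm (x1 - s *\<^sub>R h1) - 2)"
      by (simp add: a_def algebra_simps)
    also have "\<dots> \<le> a * (2 * C * s powr q)" using * ab by (intro mult_left_mono) auto
    also have "s powr q = (b / a) powr q * t powr q"
      using t ab by (simp add: s_def mult.commute flip: powr_mult)
    finally show ?thesis by (simp add: mult_ac)
  qed
  then show ?thesis by (rule that)
qed

text \<open>
  The sum of the two opposite slopes is \<open>O(t powr (q - 1))\<close> by smoothness and hence vanishes in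
  the limit; the reverse inequality is sublinearity. This upgrades the directional derivative from
  a sublinear to a linear functional.
\<close>

lemma norm_dir_minus:
  fixes x h :: "'a::real_normed_vector"
  assumes "q_smooth TYPE('a) q" "1 < q" "x \<noteq> 0"
  shows "norm_dir x (- h) = - norm_dir x h"
proof (rule antisym)
  obtain K where K: "\<And>t. t > 0 \<Longrightarrow> norm (x + t *\<^sub>R h) + norm (x - t *\<^sub>R h) - 2 * norm x \<le> K * t powr q"
    using q_smooth_norm_bound[OF assms(1,3), of h] by blast
  have "norm_dir x h + norm_dir x (- h) \<le> K * 0"
  proof (rule tendsto_le[OF _ _ tendsto_add[OF norm_dir_tendsto norm_dir_tendsto]])
    have "((\<lambda>t::real. t powr (q - 1)) \<longlongrightarrow> 0 powr (q - 1)) (at_right 0)"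
      using assms(2) by (intro tendsto_powr' tendsto_intros) (auto simp: eventually_at_right_field intro!: exI[of _ 1])
    then show "((\<lambda>t. K * t powr (q - 1)) \<longlongrightarrow> K * 0) (at_right 0)"
      by (intro tendsto_mult_left) simp
    show "\<forall>\<^sub>F t in at_right 0. (norm (x + t *\<^sub>R h) - norm x) / t + (norm (x + t *\<^sub>R - h) - norm x) / t
        \<le> K * t powr (q - 1)"
    proof (rule eventually_at_rightI[of 0 1])
      fix t :: real assume t: "t \<in> {0<..<1}"
      then show "(norm (x + t *\<^sub>R h) - norm x) / t + (norm (x + t *\<^sub>R - h) - norm x) / t \<le> K * t powr (q - 1)"
        using divide_right_mono[OF K[of t], of t]
        by (simp add: powr_diff diff_divide_distrib add_divide_distrib)
    qed simp
  qed simp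
  then show "norm_dir x (- h) \<le> - norm_dir x h" by simp
  have "norm_dir x 0 = 0" using norm_dir_abs_le[of x 0] by simp
  then show "- norm_dir x h \<le> norm_dir x (- h)"
    using norm_dir_add_le[of x h "- h"] by simp
qed

lemma bounded_linear_norm_dir:
  fixes x :: "'a::real_normed_vector"
  assumes "q_smooth TYPE('a) q" "1 < q" "x \<noteq> 0"
  shows "bounded_linear (norm_dir x)"
proof (rule bounded_linear_intro)
  note minus = norm_dir_minus[OF assms]
  show "norm_dir x (h + k) = norm_dir x h + norm_dir x k" for h k
    using norm_dir_add_le[of x h k] norm_dir_add_le[of x "h + k" "- k"] minus[of k] by simp
  have zero: "norm_dir x 0 = 0" using norm_dir_abs_le[of x 0] by simp
  show "norm_dir x (c *\<^sub>R h) = c *\<^sub>R norm_dir x h" for c h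
    using norm_dir_scale[of c x h] norm_dir_scale[of "- c" x h] minus[of "c *\<^sub>R h"] zero
    by (cases c "0::real" rule: linorder_cases) auto
  show "norm (norm_dir x h) \<le> norm h * 1" for h
    using norm_dir_abs_le[of x h] by simp
qed

lemma norm_along_line_has_derivative:
  fixes x h :: "'a::real_normed_vector"
  assumes "q_smooth TYPE('a) q" "1 < q" "x \<noteq> 0"
  shows "((\<lambda>t. norm (x + t *\<^sub>R h)) has_real_derivative norm_dir x h) (at 0)"
  unfolding has_field_derivative_iff
proof (simp, subst filterlim_at_split, intro conjI)
  show "((\<lambda>t. (norm (x + t *\<^sub>R h) - norm x) / t) \<longlongrightarrow> norm_dir x h) (at_right 0)"
    by (rule norm_dir_tendsto)
  have "((\<lambda>t. - ((norm (x + t *\<^sub>R - h) - norm x) / t)) \<longlongrightarrow> - norm_dir x (- h)) (at_right 0)"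
    by (intro tendsto_minus norm_dir_tendsto)
  then show "((\<lambda>t. (norm (x + t *\<^sub>R h) - norm x) / t) \<longlongrightarrow> norm_dir x h) (at_left 0)"
    using norm_dir_minus[OF assms, of h]
    by (subst filterlim_at_left_to_right) simp
qed

text \<open>
  A functional of norm at most 1 that attains \<open>\<parallel>x\<parallel>\<close> at \<open>x\<close> lies below every slope, hence below the
  directional derivative; two linear functionals one of which lies below the other coincide.
\<close>

lemma norming_functional_unique:
  fixes x :: "'a::real_normed_vector"
  assumes "q_smooth TYPE('a) q" "1 < q" "x \<noteq> 0"
    and "blinfun_apply f x = norm x" "norm f \<le> 1"
  shows "blinfun_apply f = norm_dir x"
proof
  have le: "blinfun_apply f h \<le> norm_dir x h" for h
  proof (rule tendsto_lowerbound[OF norm_dir_tendsto])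
    show "\<forall>\<^sub>F t in at_right 0. blinfun_apply f h \<le> (norm (x + t *\<^sub>R h) - norm x) / t"
    proof (rule eventually_at_rightI[of 0 1])
      fix t :: real assume t: "t \<in> {0<..<1}"
      have "blinfun_apply f (x + t *\<^sub>R h) \<le> norm f * norm (x + t *\<^sub>R h)"
        using norm_blinfun[of f "x + t *\<^sub>R h"] by simp
      also have "\<dots> \<le> norm (x + t *\<^sub>R h)" using assms(5) by (simp add: mult_left_le_one_le)
      finally show "blinfun_apply f h \<le> (norm (x + t *\<^sub>R h) - norm x) / t"
        using t assms(4) by (simp add: blinfun.bilinear_simps field_simps)
    qed simp
  qed simp
  fix h
  show "blinfun_apply f h = norm_dir x h"
    using le[of h] le[of "- h"] norm_dir_minus[OF assms(1-3), of h] by (simp add: blinfun.minus_right)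
qed

text \<open>
  The description operator in \<^const>\<open>J\<close> is meaningful because in a smooth space the directional
  derivative of the norm, rescaled by \<open>\<parallel>x\<parallel> powr (p - 1)\<close>, is the one functional that satisfies
  the defining conditions.
\<close>

lemma
  fixes x :: "'a::real_normed_vector"
  assumes "q_smooth TYPE('a) q" "1 < q" "1 < p"
  shows J_in_duality_mapping: "J p x \<in> duality_mapping p x"
    and duality_mapping_unique: "f \<in> duality_mapping p x \<Longrightarrow> f = J p x"
    and J_apply: "x \<noteq> 0 \<Longrightarrow> blinfun_apply (J p x) h = norm x powr (p - 1) * norm_dir x h"
proof -
  define N where "N = (if x = 0 then 0 else norm x powr (p - 1) *\<^sub>R Blinfun (norm_dir x))"
  have N_apply: "blinfun_apply N h = norm x powr (p - 1) * norm_dir x h" if "x \<noteq> 0" for h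
    using that bounded_linear_Blinfun_apply[OF bounded_linear_norm_dir[OF assms(1,2) that]]
    by (simp add: N_def blinfun.bilinear_simps)
  have N_in: "N \<in> duality_mapping p x"
  proof (cases "x = 0")
    case True then show ?thesis using assms by (simp add: N_def duality_mapping_def)
  next
    case False
    have "norm N = norm x powr (p - 1)"
    proof (rule norm_blinfun_eqI[of _ _ x])
      show "norm x powr (p - 1) \<le> norm (blinfun_apply N x) / norm x"
        using False by (simp add: N_apply norm_dir_self abs_mult)
      show "norm (blinfun_apply N h) \<le> norm x powr (p - 1) * norm h" for h
        using False norm_dir_abs_le[of x h] by (simp add: N_apply abs_mult mult_left_mono)
    qed simp
    then show ?thesis using False by (simp add: duality_mapping_def N_apply norm_dir_self)
  qed
  have uniq: "f = N" if f: "f \<in> duality_mapping p x" for f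
  proof (cases "x = 0")
    case True
    then show ?thesis using f assms by (simp add: N_def duality_mapping_def)
  next
    case False
    define c where "c = norm x powr (p - 1)"
    have c: "c > 0" using False by (simp add: c_def)
    have "blinfun_apply ((1/c) *\<^sub>R f) = norm_dir x"
    proof (rule norming_functional_unique[OF assms(1,2) False])
      show "blinfun_apply ((1/c) *\<^sub>R f) x = norm x" "norm ((1/c) *\<^sub>R f) \<le> 1"
        using f c by (simp_all add: duality_mapping_def blinfun.bilinear_simps flip: c_def)
    qed
    then have "blinfun_apply f h = c * norm_dir x h" for h
      using c by (simp add: blinfun.scaleR_left field_simps fun_eq_iff)
    then show ?thesis using N_apply[OF False] by (intro blinfun_eqI) (simp add: c_def)
  qed
  have "J p x = N" unfolding J_def using N_in uniq by (rule the_equality)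
  show "J p x \<in> duality_mapping p x" unfolding \<open>J p x = N\<close> by (rule N_in)
  show "f = J p x" if "f \<in> duality_mapping p x" unfolding \<open>J p x = N\<close> using that by (rule uniq)
  show "blinfun_apply (J p x) h = norm x powr (p - 1) * norm_dir x h" if "x \<noteq> 0"
    unfolding \<open>J p x = N\<close> using that by (rule N_apply)
qed

text \<open>
  The duality mapping is the Gateaux derivative of \<open>\<parallel>x\<parallel> powr p / p\<close>. At the origin, where the norm
  itself has a kink in every direction \<open>h \<noteq> 0\<close>, this holds because \<open>p > 1\<close>.
\<close>

lemma powr_norm_along_line_has_derivative:
  fixes x h :: "'a::real_normed_vector"
  assumes "q_smooth TYPE('a) q" "1 < q" "1 < p"
  shows "((\<lambda>t. 1/p * norm (x + t *\<^sub>R h) powr p) has_real_derivative blinfun_apply (J p x) h) (at 0)"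
proof (cases "x = 0")
  case True
  have "J p x = 0"
    using duality_mapping_unique[OF assms, of 0 x] True assms by (simp add: duality_mapping_def)
  have "((\<lambda>t::real. \<bar>t\<bar> powr (p - 1)) \<longlongrightarrow> 0 powr (p - 1)) (at 0)"
    using assms(3) by (intro tendsto_powr' tendsto_eq_intros | simp)+
  then have "((\<lambda>t::real. (1/p * norm h powr p) * \<bar>\<bar>t\<bar> powr (p - 1)\<bar>) \<longlongrightarrow> (1/p * norm h powr p) * \<bar>0\<bar>) (at 0)"
    by (intro tendsto_intros) simp
  moreover have "(1/p * norm h powr p) * \<bar>\<bar>t\<bar> powr (p - 1)\<bar> = \<bar>1/p * norm (t *\<^sub>R h) powr p / t\<bar>" if "t \<noteq> 0" for t
    using that assms(3) by (simp add: powr_diff powr_mult abs_mult abs_divide)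
  then have "\<forall>\<^sub>F t in at 0. (1/p * norm h powr p) * \<bar>\<bar>t\<bar> powr (p - 1)\<bar> = \<bar>1/p * norm (t *\<^sub>R h) powr p / t\<bar>"
    by (intro eventually_at_filter[THEN iffD2] always_eventually) blast
  ultimately have "((\<lambda>t. \<bar>1/p * norm (t *\<^sub>R h) powr p / t\<bar>) \<longlongrightarrow> (1/p * norm h powr p) * \<bar>0\<bar>) (at 0)"
    by (rule Lim_transform_eventually)
  then have "((\<lambda>t. \<bar>1/p * norm (t *\<^sub>R h) powr p / t\<bar>) \<longlongrightarrow> 0) (at 0)"
    by simp
  then have "((\<lambda>t. 1/p * norm (t *\<^sub>R h) powr p / t) \<longlongrightarrow> 0) (at 0)"
    by (rule tendsto_rabs_zero_cancel)
  then show ?thesis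
    unfolding has_field_derivative_iff using True \<open>J p x = 0\<close> by simp
next
  case False
  have "((\<lambda>t. norm (x + t *\<^sub>R h) powr p) has_real_derivative
      p * norm (x + 0 *\<^sub>R h) powr (p - of_nat 1) * norm_dir x h) (at 0)"
    by (rule DERIV_fun_powr[OF norm_along_line_has_derivative[OF assms(1,2) False]]) (use False in simp)
  then have "((\<lambda>t. 1/p * norm (x + t *\<^sub>R h) powr p) has_real_derivative
      1/p * (p * norm (x + 0 *\<^sub>R h) powr (p - of_nat 1) * norm_dir x h)) (at 0)"
    by (rule DERIV_cmult)
  then show ?thesis using assms(3) by (simp add: J_apply[OF assms False])
qed

section \<open>Bregman distances in a smooth and convex space\<close>

text \<open>
  Convexity of the space enters through a power-type lower bound on the Bregman distance, whose
  constant \<open>c\<close> is \<open>C\<^sub>p / p\<close> in the application. The parameter \<open>X\<close> ties the locale to a type.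
\<close>

locale bregman_space =
  fixes p q c :: real and X :: "'a::banach itself"
  assumes p_gt_1: "1 < p" and q_gt_1: "1 < q" and conj_exponents: "1/p + 1/q = 1"
    and smooth: "q_smooth TYPE('a) q"
    and c_pos: "0 < c"
    and bregman_ge: "\<And>a b :: 'a. c * norm (a - b) powr p \<le> bregman p a b"
begin

lemma exponent_eqs: "(p - 1) * (q - 1) = 1" "(p - 1) * q = p" "(q - 1) * p = q"
proof -
  have "p + q = p * q" using conj_exponents p_gt_1 q_gt_1 by (simp add: field_simps)
  then show "(p - 1) * (q - 1) = 1" "(p - 1) * q = p" "(q - 1) * p = q" by (simp_all add: algebra_simps)
qed

lemma norm_J: "norm (J p (x::'a)) = norm x powr (p - 1)"
  and J_self: "blinfun_apply (J p (x::'a)) x = norm x powr p"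
  using J_in_duality_mapping[OF smooth q_gt_1 p_gt_1, of x]
  by (auto simp: duality_mapping_def powr_mult_base)

lemma bregman_nonneg: "0 \<le> bregman p (a::'a) b"
  using bregman_ge[of a b] c_pos by (smt (verit) mult_nonneg_nonneg powr_ge_zero)

lemma J_mono: "0 \<le> blinfun_apply (J p b - J p a) (b - a :: 'a)"
  using bregman_nonneg[of a b] bregman_nonneg[of b a]
  by (simp add: bregman_def blinfun.bilinear_simps)

lemma J_inj:
  assumes "J p a = J p (b::'a)"
  shows "a = b"
proof (rule ccontr)
  assume "a \<noteq> b"
  then have "0 < c * norm (a - b) powr p" "0 < c * norm (b - a) powr p" using c_pos by auto
  then show False
    using bregman_ge[of a b] bregman_ge[of b a] assms
    by (simp add: bregman_def blinfun.bilinear_simps)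
qed

text \<open>
  Written with the dual norm, the dependence of the Bregman distance on its first argument goes
  only through the dual point \<open>J p a\<close>. This is the form in which a gradient step in the dual space
  can be evaluated.
\<close>

lemma bregman_alt:
  "bregman p (a::'a) b = 1/p * norm b powr p + 1/q * norm (J p a) powr q - blinfun_apply (J p a) b"
proof -
  have "norm (J p a) powr q = norm a powr p" by (simp only: norm_J powr_powr exponent_eqs)
  moreover have "1/q = 1 - 1/p" using conj_exponents by simp
  ultimately have "1/q * norm (J p a) powr q = (1 - 1/p) * norm a powr p" by simp
  then show ?thesis by (simp add: bregman_def blinfun.bilinear_simps J_self algebra_simps)
qed

text \<open>
  The Bregman distance to \<open>z\<close> need not be convex in its first argument, so its sublevel sets need not be
  convex. They are star-shaped about \<open>z\<close>, however, because the duality mapping is monotone, and this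
  suffices for Taylor estimates along segments that end in \<open>z\<close>.
\<close>

lemma bregman_star_shaped:
  fixes x z :: 'a
  assumes "0 \<le> s" "s \<le> 1"
  shows "bregman p (z + s *\<^sub>R (x - z)) z \<le> bregman p x z"
proof (cases "s = 1")
  case False
  define a where "a = z + s *\<^sub>R (x - z)"
  have xa: "x - a = (1 - s) *\<^sub>R (x - z)" and az: "a - z = s *\<^sub>R (x - z)"
    by (simp_all add: a_def algebra_simps)
  have "0 \<le> (1 - s) * blinfun_apply (J p x - J p a) (x - z)"
    using J_mono[where b = x and a = a] by (simp only: xa blinfun.scaleR_right real_scaleR_def)
  then have "0 \<le> blinfun_apply (J p x - J p a) (x - z)"
    using False assms by (simp add: zero_le_mult_iff)
  then have "0 \<le> blinfun_apply (J p x - J p a) (a - z)"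
    using assms by (simp add: az blinfun.scaleR_right)
  then show ?thesis
    using bregman_nonneg[of x a]
    by (simp add: bregman_def blinfun.bilinear_simps flip: a_def)
qed simp

section \<open>Minimizing the tilted energy over a closed convex set\<close>

text \<open>
  The energy \<open>\<parallel>x\<parallel> powr p / p\<close> tilted by a functional \<open>g\<close> is bounded below, because for \<open>p > 1\<close> it
  outgrows the linear term once \<open>\<parallel>x\<parallel> powr (p - 1)\<close> exceeds \<open>p \<parallel>g\<parallel>\<close>.
\<close>

lemma energy_lower_bound:
  fixes g :: "'a \<Rightarrow>\<^sub>L real"
  shows "- norm g * (p * norm g) powr (1/(p - 1)) \<le> 1/p * norm x powr p - blinfun_apply g x"
proof -
  define S where "S = (p * norm g) powr (1/(p - 1))"
  have g: "blinfun_apply g x \<le> norm g * norm x" using norm_blinfun[of g x] by simp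
  show ?thesis
  proof (cases "norm x \<le> S")
    case True
    then have "norm g * norm x \<le> norm g * S" by (simp add: mult_left_mono)
    moreover have "0 \<le> 1/p * norm x powr p" using p_gt_1 by simp
    ultimately show ?thesis using g by (simp flip: S_def)
  next
    case False
    have "p * norm g = S powr (p - 1)" using p_gt_1 by (simp add: S_def powr_powr)
    also have "\<dots> \<le> norm x powr (p - 1)" using False p_gt_1 by (intro powr_mono2) (auto simp: S_def)
    finally have "norm x * (p * norm g) \<le> norm x powr p"
      using powr_mult_base[of "norm x" "p - 1"] mult_left_mono[of _ _ "norm x"] by fastforce
    then have "norm g * norm x \<le> 1/p * norm x powr p" using p_gt_1 by (simp add: field_simps)
    moreover have "0 \<le> norm g * S" by (simp add: S_def)
    ultimately show ?thesis using g by (simp flip: S_def)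
  qed
qed

text \<open>
  The linear terms of the two Bregman distances from the midpoint cancel, so the tilted energy
  inherits uniform midpoint convexity from the lower bound on the Bregman distance.
\<close>

lemma energy_midpoint:
  fixes g :: "'a \<Rightarrow>\<^sub>L real" and a b :: 'a
  defines "h \<equiv> \<lambda>x. 1/p * norm x powr p - blinfun_apply g x"
  shows "2 * c * (norm (a - b) / 2) powr p \<le> h a + h b - 2 * h ((1/2) *\<^sub>R (a + b))"
proof -
  define m where "m = (1/2) *\<^sub>R (a + b)"
  have ma: "m - a = - (1/2) *\<^sub>R (a - b)" and mb: "m - b = (1/2) *\<^sub>R (a - b)"
    by (simp_all add: m_def algebra_simps flip: scaleR_add_left)
  have n: "norm (m - a) = norm (a - b) / 2" "norm (m - b) = norm (a - b) / 2"
    by (simp_all add: ma mb)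
  have "2 *\<^sub>R m = a + b" by (simp add: m_def)
  then have eq: "a - m = - (b - m)" by (simp add: scaleR_2 algebra_simps)
  have "bregman p m a + bregman p m b = h a + h b - 2 * h m"
    unfolding bregman_def eq by (simp add: h_def m_def blinfun.bilinear_simps field_simps)
  then show ?thesis
    using bregman_ge[of m a] bregman_ge[of m b] by (simp add: n flip: m_def)
qed

text \<open>
  By midpoint convexity, a minimizing sequence is Cauchy, so its limit, which exists by
  completeness, is a minimizer. Taking all of the space as the set gives surjectivity of
  the duality mapping; taking \<open>g = J p x\<close> gives the Bregman projection of \<open>x\<close>.
\<close>

lemma energy_minimizer_exists:
  fixes g :: "'a \<Rightarrow>\<^sub>L real" and Z :: "'a set"
  assumes "closed Z" "convex Z" "Z \<noteq> {}"
  obtains P where "P \<in> Z"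
    "\<And>z. z \<in> Z \<Longrightarrow> 1/p * norm P powr p - blinfun_apply g P \<le> 1/p * norm z powr p - blinfun_apply g z"
proof -
  define h where "h = (\<lambda>x. 1/p * norm x powr p - blinfun_apply g x)"
  define I where "I = Inf (h ` Z)"
  have bdd: "bdd_below (h ` Z)"
    using energy_lower_bound[of g] by (intro bdd_belowI2) (auto simp: h_def)
  have I_le: "I \<le> h z" if "z \<in> Z" for z
    unfolding I_def using bdd that by (rule cINF_lower)
  have "\<exists>z\<in>Z. h z < I + 1 / real (Suc n)" for n
    using cINF_less_iff[OF assms(3) bdd, of "I + 1 / real (Suc n)"] by (simp add: I_def)
  then obtain s where s: "\<And>n. s n \<in> Z" "\<And>n. h (s n) < I + 1 / real (Suc n)" by metis
  have close: "2 * c * (norm (s m - s n) / 2) powr p \<le> 2 / real (Suc N)" if "m \<ge> N" "n \<ge> N" for m n N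
  proof -
    have "(1/2) *\<^sub>R (s m + s n) \<in> Z"
      using convexD[OF assms(2) s(1) s(1), of "1/2" "1/2" m n] by (simp add: scaleR_add_right)
    then have "2 * c * (norm (s m - s n) / 2) powr p \<le> h (s m) + h (s n) - 2 * I"
      using energy_midpoint[of "s m" "s n" g] I_le unfolding h_def by fastforce
    also have "\<dots> \<le> 1 / real (Suc m) + 1 / real (Suc n)" using s(2)[of m] s(2)[of n] by simp
    also have "\<dots> \<le> 1 / real (Suc N) + 1 / real (Suc N)"
      using that by (intro add_mono divide_left_mono) auto
    finally show ?thesis by simp
  qed
  have "Cauchy s"
  proof (rule CauchyI)
    fix e :: real assume e: "0 < e"
    then have "0 < c * (e / 2) powr p" using c_pos by simp
    then obtain N where N: "1 / real (Suc N) < c * (e / 2) powr p" using nat_approx_posE by blast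
    have "norm (s m - s n) < e" if "m \<ge> N" "n \<ge> N" for m n
    proof (rule ccontr)
      assume "\<not> norm (s m - s n) < e"
      then have "c * (e / 2) powr p \<le> c * (norm (s m - s n) / 2) powr p"
        using e p_gt_1 c_pos by (intro mult_left_mono powr_mono2) auto
      then show False using close[OF that] N by simp
    qed
    then show "\<exists>M. \<forall>m\<ge>M. \<forall>n\<ge>M. norm (s m - s n) < e" by blast
  qed
  then obtain P where P: "s \<longlonglongrightarrow> P" using Cauchy_convergent_iff convergent_def by blast
  show ?thesis
  proof (rule that)
    show "P \<in> Z" using closed_sequentially[OF assms(1)] s(1) P by blast
    have "(\<lambda>n. h (s n)) \<longlonglongrightarrow> h P"
      unfolding h_def using P p_gt_1 by (intro tendsto_intros) auto
    moreover have "(\<lambda>n. I + 1 / real (Suc n)) \<longlonglongrightarrow> I + 0"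
      using LIMSEQ_inverse_real_of_nat by (intro tendsto_intros) (simp add: inverse_eq_divide)
    ultimately have "h P \<le> I + 0"
      using s(2) by (intro LIMSEQ_le) (auto intro: less_imp_le)
    then show "1/p * norm P powr p - blinfun_apply g P \<le> 1/p * norm z powr p - blinfun_apply g z" if "z \<in> Z" for z
      using I_le[OF that] by (simp add: h_def)
  qed
qed

text \<open>
  First-order optimality: the derivative of the energy at the minimizer is nonnegative in every
  direction that points into the set.
\<close>

lemma energy_minimizer_variational:
  fixes g :: "'a \<Rightarrow>\<^sub>L real" and Z :: "'a set"
  assumes "convex Z" "P \<in> Z" "z \<in> Z"
    and "\<And>z. z \<in> Z \<Longrightarrow> 1/p * norm P powr p - blinfun_apply g P \<le> 1/p * norm z powr p - blinfun_apply g z"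
  shows "0 \<le> blinfun_apply (J p P - g) (z - P)"
proof (rule ccontr)
  assume neg: "\<not> ?thesis"
  define h where "h = (\<lambda>t. 1/p * norm (P + t *\<^sub>R (z - P)) powr p - blinfun_apply g (P + t *\<^sub>R (z - P)))"
  have "((\<lambda>t. blinfun_apply g P + t * blinfun_apply g (z - P)) has_real_derivative blinfun_apply g (z - P)) (at 0)"
    by (auto intro!: derivative_eq_intros)
  then have "((\<lambda>t. blinfun_apply g (P + t *\<^sub>R (z - P))) has_real_derivative blinfun_apply g (z - P)) (at 0)"
    by (simp add: blinfun.bilinear_simps)
  then have "(h has_real_derivative blinfun_apply (J p P) (z - P) - blinfun_apply g (z - P)) (at 0)"
    unfolding h_def by (intro DERIV_diff powr_norm_along_line_has_derivative[OF smooth q_gt_1 p_gt_1])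
  from DERIV_neg_dec_right[OF this] neg
  obtain d where d: "d > 0" "\<And>t. 0 < t \<Longrightarrow> t < d \<Longrightarrow> h t < h 0"
    by (auto simp: blinfun.diff_left)
  define t where "t = min 1 (d/2)"
  have t: "0 < t" "t < d" "t \<le> 1" using d(1) by (auto simp: t_def)
  have "P + t *\<^sub>R (z - P) = (1 - t) *\<^sub>R P + t *\<^sub>R z" by (simp add: algebra_simps)
  then have "P + t *\<^sub>R (z - P) \<in> Z"
    using convexD_alt[OF assms(1-3), of t] t by simp
  from assms(4)[OF this] have "h 0 \<le> h t" by (simp add: h_def)
  with d(2)[OF t(1,2)] show False by simp
qed

section \<open>The inverse duality mapping and the Bregman projection\<close>

lemma J_surj: "\<exists>x::'a. J p x = g"
proof -
  obtain P :: 'a where P: "\<And>z. 1/p * norm P powr p - blinfun_apply g P \<le> 1/p * norm z powr p - blinfun_apply g z"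
    using energy_minimizer_exists[of UNIV g] by auto
  have var: "0 \<le> blinfun_apply (J p P - g) (z - P)" for z
    using energy_minimizer_variational[of UNIV P z g] P by simp
  have "blinfun_apply (J p P - g) h = 0" for h
    using var[of "P + h"] var[of "P - h"] by (simp add: blinfun.minus_right)
  then have "J p P - g = 0" by (intro blinfun_eqI) simp
  then show ?thesis by auto
qed

lemma norm_bidual_embedding: "norm (bidual_embedding (x::'a)) = norm x"
proof (cases "x = 0")
  case True
  have "bidual_embedding (0::'a) = 0" by (rule blinfun_eqI) (simp add: bidual_embedding.rep_eq)
  then show ?thesis using True by simp
next
  case False
  show ?thesis
  proof (rule norm_blinfun_eqI[of _ _ "J p x"])
    show "norm x \<le> norm (blinfun_apply (bidual_embedding x) (J p x)) / norm (J p x)"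
      using False by (simp add: bidual_embedding.rep_eq J_self norm_J powr_diff)
    show "norm (blinfun_apply (bidual_embedding x) f) \<le> norm x * norm f" for f
      using norm_blinfun[of f x] by (simp add: bidual_embedding.rep_eq mult.commute)
  qed simp
qed

text \<open>
  The two duality relations have the same content, read from either side of the pairing, because
  the gauge functions of conjugate exponents are inverse to each other. Thus the points that define
  \<^const>\<open>J_dual\<close> are exactly the preimages under \<open>J p\<close>.
\<close>

lemma bidual_in_duality_mapping_iff:
  "bidual_embedding (x::'a) \<in> duality_mapping q g \<longleftrightarrow> J p x = g"
proof -
  have "norm x = norm g powr (q - 1) \<longleftrightarrow> norm g = norm x powr (p - 1)"
    using exponent_eqs(1) by (auto simp: powr_powr mult.commute)
  then have "bidual_embedding x \<in> duality_mapping q g \<longleftrightarrow> g \<in> duality_mapping p x"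
    by (auto simp: duality_mapping_def norm_bidual_embedding bidual_embedding.rep_eq mult.commute)
  also have "\<dots> \<longleftrightarrow> J p x = g"
    using J_in_duality_mapping[OF smooth q_gt_1 p_gt_1] duality_mapping_unique[OF smooth q_gt_1 p_gt_1] by metis
  finally show ?thesis .
qed

lemma J_J_dual: "J p (J_dual q g :: 'a) = g"
proof -
  obtain x :: 'a where x: "J p x = g" using J_surj by blast
  then have "J_dual q g = x"
    unfolding J_dual_def bidual_in_duality_mapping_iff using J_inj by (intro the_equality) auto
  then show ?thesis using x by simp
qed

lemma J_dual_J: "J_dual q (J p (x::'a)) = x"
  by (rule J_inj) (rule J_J_dual)

text \<open>
  The effect of a gradient step in the dual space on the distance to \<open>z\<close>: a first-order term and
  a remainder, which is itself a Bregman distance of the dual space and hence is controlled by the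
  smoothness of the dual.
\<close>

lemma bregman_dual_step:
  fixes a z :: 'a
  shows "bregman p (J_dual q (J p a - g)) z
      = bregman p a z + bregman_dual q (J p a) (J p a - g) + blinfun_apply g (z - a)"
  by (simp add: bregman_alt bregman_dual_def J_J_dual J_dual_J blinfun.bilinear_simps)

text \<open>
  Up to a constant, \<open>bregman p x\<close> is the energy tilted by \<open>J p x\<close>, so the projection is a
  minimizer \<open>Q\<close> of that energy. The distance to \<open>z\<close> decreases by the three-point
  identity \<open>bregman p x z = bregman p x Q + bregman p Q z + (J p Q - J p x) (z - Q)\<close>, whose last
  term is nonnegative by optimality.
\<close>

lemma
  fixes Z :: "'a set"
  assumes "closed Z" "convex Z" "z \<in> Z"
  shows bregman_proj_mem: "bregman_proj p Z x \<in> Z"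
    and bregman_proj_le: "bregman p (bregman_proj p Z x) z \<le> bregman p x z"
proof -
  have eq: "bregman p x a \<le> bregman p x b \<longleftrightarrow>
    1/p * norm a powr p - blinfun_apply (J p x) a \<le> 1/p * norm b powr p - blinfun_apply (J p x) b" for a b
    by (auto simp: bregman_alt)
  obtain P where P: "P \<in> Z" "\<And>b. b \<in> Z \<Longrightarrow> bregman p x P \<le> bregman p x b"
    using energy_minimizer_exists[OF assms(1,2), of "J p x"] assms(3) unfolding eq by blast
  define Q where "Q = bregman_proj p Z x"
  have Q: "Q \<in> Z \<and> (\<forall>b\<in>Z. bregman p x Q \<le> bregman p x b)"
    unfolding Q_def bregman_proj_def arg_min_on_def
    by (rule arg_minI[of _ P]) (use P in \<open>auto simp: not_less\<close>)
  then show "bregman_proj p Z x \<in> Z" by (simp add: Q_def)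
  have "0 \<le> blinfun_apply (J p Q - J p x) (z - Q)"
    by (rule energy_minimizer_variational[OF assms(2) _ assms(3)]) (use Q eq in auto)
  then have "bregman p Q z \<le> bregman p x z"
    using bregman_nonneg[of x Q] by (simp add: bregman_def blinfun.bilinear_simps)
  then show "bregman p (bregman_proj p Z x) z \<le> bregman p x z" by (simp add: Q_def)
qed

end

section \<open>Linearization error and the discrepancy quadratic\<close>

text \<open>
  Only the distance to the base point \<open>x\<close> enters the Lipschitz hypothesis, and only on one segment,
  so the estimate applies in star-shaped sets.
\<close>

lemma linearization_error_segment:
  fixes F :: "'a::real_normed_vector \<Rightarrow> 'b::real_normed_vector"
  assumes der: "\<And>a. a \<in> closed_segment x z \<Longrightarrow>
      (F has_derivative blinfun_apply (DF a)) (at a within closed_segment x z)"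
    and lip: "\<And>a. a \<in> closed_segment x z \<Longrightarrow> norm (DF a - DF x) \<le> L * norm (a - x)"
  shows "norm (F z - F x - blinfun_apply (DF x) (z - x)) \<le> L/2 * (norm (z - x))\<^sup>2"
proof -
  define \<gamma> where "\<gamma> = (\<lambda>s::real. x + s *\<^sub>R (z - x))"
  have \<gamma>_in: "\<gamma> s \<in> closed_segment x z" if "0 \<le> s" "s \<le> 1" for s
    using that by (auto simp: \<gamma>_def in_segment algebra_simps intro!: exI[of _ s])
  define f where "f = (\<lambda>s. F (\<gamma> s) - s *\<^sub>R blinfun_apply (DF x) (z - x))"
  have f_der: "(f has_vector_derivative blinfun_apply (DF (\<gamma> s) - DF x) (z - x)) (at s within {0..1})"
    if "0 \<le> s" "s \<le> 1" for s
  proof -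
    have "(\<gamma> has_derivative (\<lambda>h. h *\<^sub>R (z - x))) (at s within {0..1})"
      unfolding \<gamma>_def by (auto intro!: derivative_eq_intros)
    moreover have "(F has_derivative blinfun_apply (DF (\<gamma> s))) (at (\<gamma> s) within \<gamma> ` {0..1})"
      using der[OF \<gamma>_in[OF that]] by (rule has_derivative_subset) (auto intro: \<gamma>_in)
    ultimately have "((\<lambda>s. F (\<gamma> s)) has_derivative (\<lambda>h. blinfun_apply (DF (\<gamma> s)) (h *\<^sub>R (z - x)))) (at s within {0..1})"
      by (rule has_derivative_in_compose)
    then have "((\<lambda>s. F (\<gamma> s)) has_vector_derivative blinfun_apply (DF (\<gamma> s)) (z - x)) (at s within {0..1})"
      by (simp add: has_vector_derivative_def blinfun.scaleR_right)
    then show ?thesis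
      unfolding f_def by (auto intro!: derivative_eq_intros simp: blinfun.diff_left)
  qed
  define \<phi> where "\<phi> = (\<lambda>s::real. L/2 * s\<^sup>2 * (norm (z - x))\<^sup>2)"
  have \<phi>_der: "(\<phi> has_vector_derivative L * s * (norm (z - x))\<^sup>2) (at s)" for s
    unfolding \<phi>_def by (auto intro!: derivative_eq_intros simp flip: has_real_derivative_iff_has_vector_derivative)
  have "norm (f 1 - f 0) \<le> \<phi> 1 - \<phi> 0"
  proof (rule differentiable_bound_general)
    show "continuous_on {0..1} f"
      using f_der by (intro continuous_on_vector_derivative) auto
    show "continuous_on {0..1} \<phi>" unfolding \<phi>_def by (intro continuous_intros)
    fix s :: real assume s: "0 < s" "s < 1"
    show "(f has_vector_derivative blinfun_apply (DF (\<gamma> s) - DF x) (z - x)) (at s)"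
      using f_der[of s] s by (simp add: at_within_Icc_at)
    show "(\<phi> has_vector_derivative L * s * (norm (z - x))\<^sup>2) (at s)" by (rule \<phi>_der)
    have "norm (blinfun_apply (DF (\<gamma> s) - DF x) (z - x)) \<le> norm (DF (\<gamma> s) - DF x) * norm (z - x)"
      by (rule norm_blinfun)
    also have "\<dots> \<le> (L * norm (\<gamma> s - x)) * norm (z - x)"
      using s by (intro mult_right_mono lip \<gamma>_in) auto
    also have "norm (\<gamma> s - x) = s * norm (z - x)" using s by (simp add: \<gamma>_def)
    finally show "norm (blinfun_apply (DF (\<gamma> s) - DF x) (z - x)) \<le> L * s * (norm (z - x))\<^sup>2"
      by (simp add: power2_eq_square mult_ac)
  qed simp
  then show ?thesis by (simp add: f_def \<phi>_def \<gamma>_def algebra_simps)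
qed

text \<open>
  In the application \<open>s = r + \<eta>\<close>, and then the quadratic \<open>s - 2 \<eta> - K s\<^sup>2\<close> is the quantity \<open>u\<close> that
  scales the step. It factors as \<open>K (s - \<alpha>) (\<beta> - s)\<close> with \<open>\<alpha> < 4 \<eta>\<close>; so as long as
  the discrepancy criterion fails and \<open>s\<close> stays below some \<open>\<sigma> < \<beta>\<close>, it has a
  positive lower bound that is independent of the iteration.
\<close>

lemma discrepancy_quadratic_lower_bound:
  fixes K \<eta> \<sigma> :: real
  assumes "0 < K" "0 < \<eta>" "8 * K * \<eta> < 1" "\<sigma> < (1 + sqrt (1 - 8 * K * \<eta>)) / (2 * K)"
  obtains m where "0 < m" "\<And>s. 4 * \<eta> \<le> s \<Longrightarrow> s \<le> \<sigma> \<Longrightarrow> m \<le> s - 2 * \<eta> - K * s\<^sup>2"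
proof -
  define d where "d = sqrt (1 - 8 * K * \<eta>)"
  define \<alpha> \<beta> where "\<alpha> = (1 - d) / (2 * K)" and "\<beta> = (1 + d) / (2 * K)"
  have d2: "d\<^sup>2 = 1 - 8 * K * \<eta>" using assms by (simp add: d_def)
  have d01: "0 < d" "d < 1" using assms by (auto simp: d_def)
  have factor: "s - 2 * \<eta> - K * s\<^sup>2 = K * ((s - \<alpha>) * (\<beta> - s))" for s
  proof -
    have "\<alpha> + \<beta> = 1 / K" using assms(1) by (simp add: \<alpha>_def \<beta>_def field_simps)
    moreover have "\<alpha> * \<beta> = 2 * \<eta> / K"
    proof -
      have "\<alpha> * \<beta> = (1 - d\<^sup>2) / (4 * K\<^sup>2)"
        by (simp add: \<alpha>_def \<beta>_def power2_eq_square algebra_simps)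
      also have "\<dots> = 2 * \<eta> / K" unfolding d2 using assms(1) by (simp add: field_simps power2_eq_square)
      finally show ?thesis .
    qed
    moreover have "K * ((s - \<alpha>) * (\<beta> - s)) = K * (\<alpha> + \<beta>) * s - K * (\<alpha> * \<beta>) - K * s\<^sup>2"
      by (simp add: algebra_simps power2_eq_square)
    ultimately show ?thesis using assms(1) by simp
  qed
  \<comment> \<open>The condition \<open>\<alpha> < 4 \<eta>\<close> amounts to \<open>1 - d < 1 - d\<^sup>2\<close>.\<close>
  have "d\<^sup>2 < d" using d01 by (simp add: power2_eq_square)
  then have "\<alpha> < 4 * \<eta>" using assms(1) by (simp add: \<alpha>_def d2 field_simps)
  show ?thesis
  proof (rule that)
    show "0 < K * ((4 * \<eta> - \<alpha>) * (\<beta> - \<sigma>))"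
      using \<open>\<alpha> < 4 * \<eta>\<close> assms by (simp add: \<beta>_def d_def)
    show "K * ((4 * \<eta> - \<alpha>) * (\<beta> - \<sigma>)) \<le> s - 2 * \<eta> - K * s\<^sup>2" if "4 * \<eta> \<le> s" "s \<le> \<sigma>" for s
      unfolding factor
      using that \<open>\<alpha> < 4 * \<eta>\<close> assms by (intro mult_left_mono mult_mono) (auto simp: \<beta>_def d_def)
  qed
qed

section \<open>One step of projected steepest descent\<close>

context bregman_space
begin

lemma norm_diff_le_bregman: "norm (a - b :: 'a) \<le> (bregman p a b / c) powr (1/p)"
proof -
  have "norm (a - b) powr p \<le> bregman p a b / c"
    using bregman_ge[of a b] c_pos by (simp add: field_simps)
  then have "(norm (a - b) powr p) powr (1/p) \<le> (bregman p a b / c) powr (1/p)"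
    using p_gt_1 by (intro powr_mono2) auto
  then show ?thesis using p_gt_1 by (simp add: powr_powr)
qed

lemma norm_diff_sq_le_bregman: "(norm (a - b :: 'a))\<^sup>2 \<le> c powr (-2/p) * bregman p a b powr (2/p)"
proof -
  have "(norm (a - b))\<^sup>2 \<le> ((bregman p a b / c) powr (1/p))\<^sup>2"
    by (intro power_mono norm_diff_le_bregman) simp
  also have "\<dots> = (bregman p a b / c) powr (2/p)"
    by (simp add: power2_eq_square flip: powr_add)
  also have "\<dots> = c powr (-2/p) * bregman p a b powr (2/p)"
    using c_pos bregman_nonneg[of a b] by (simp add: powr_divide powr_minus_divide)
  finally show ?thesis .
qed

lemma segment_in_bregman_ball:
  fixes x z :: 'a
  assumes "a \<in> closed_segment x z"
  shows "bregman p a z \<le> bregman p x z"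
proof -
  obtain s where s: "0 \<le> s" "s \<le> 1" "a = (1 - s) *\<^sub>R x + s *\<^sub>R z"
    using assms by (auto simp: in_segment)
  then have "a = z + (1 - s) *\<^sub>R (x - z)" by (simp add: algebra_simps)
  then show ?thesis using bregman_star_shaped[of "1 - s" z x] s by simp
qed

text \<open>
  The step size \<open>\<mu>\<close> balances a dual step: the coefficient \<open>\<mu> * r powr (p - 1)\<close> of the first-order
  gain and the remainder \<open>G / q * (\<mu> * t) powr q\<close> carry the same powers of \<open>t\<close> and \<open>r\<close> and
  differ by the factor \<open>u / q\<close> only.
\<close>

lemma step_size_powers:
  assumes pos: "0 < G" "0 < t" "0 < u" "0 < r"
  defines "A \<equiv> (G * t powr q) powr (-1/(q-1))"
  defines "\<mu> \<equiv> A * u powr (1/(q-1)) * r powr ((p-1)/(q-1))"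
  shows "\<mu> * r powr (p - 1) = A * u powr (1/(q-1)) * r powr (p\<^sup>2 - p)"
    and "G/q * (\<mu> * t) powr q = 1/q * A * u powr p * r powr (p\<^sup>2 - p)"
    and "u powr (1/(q-1)) * u = u powr p"
proof -
  have e: "1/(q-1) = p - 1" "-1/(q-1) = -(p-1)" "(p-1)/(q-1) = (p-1)\<^sup>2"
    using exponent_eqs(1) q_gt_1 by (auto simp: field_simps power2_eq_square)
  show "\<mu> * r powr (p - 1) = A * u powr (1/(q-1)) * r powr (p\<^sup>2 - p)"
    unfolding \<mu>_def e by (simp add: power2_eq_square algebra_simps flip: powr_add)
  show "u powr (1/(q-1)) * u = u powr p"
    unfolding e using pos(3) by (simp add: powr_diff)
  have A: "0 < A" using pos by (simp add: A_def)
  have A_q: "(G * t powr q) * A powr q = A"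
  proof -
    have "(G * t powr q) * A powr q = (G * t powr q) powr (1 + -(p-1) * q)"
      using pos by (simp only: A_def e powr_powr powr_add) simp
    also have "1 + -(p-1) * q = -(p-1)" using exponent_eqs(2) by (simp add: algebra_simps)
    finally show ?thesis by (simp add: A_def e)
  qed
  have "(\<mu> * t) powr q = A powr q * u powr ((p-1) * q) * r powr ((p-1)\<^sup>2 * q) * t powr q"
    using pos A by (simp add: \<mu>_def e powr_mult powr_powr)
  also have "(p-1) * q = p" by (rule exponent_eqs)
  also have "(p-1)\<^sup>2 * q = p\<^sup>2 - p"
    using exponent_eqs(2) by (simp add: power2_eq_square algebra_simps)
  finally have "G/q * (\<mu> * t) powr q = 1/q * ((G * t powr q) * A powr q) * u powr p * r powr (p\<^sup>2 - p)"
    by simp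
  then show "G/q * (\<mu> * t) powr q = 1/q * A * u powr p * r powr (p\<^sup>2 - p)"
    by (simp only: A_q)
qed

text \<open>
  The powers of \<open>r\<close> cancel against those in the bound for the gradient norm \<open>t\<close>, which leaves a
  lower bound for the decrease that does not depend on the residual.
\<close>

lemma step_gain_lower_bound:
  assumes "0 < G" "0 < t" "0 < r" "0 < M" "t \<le> M * r powr (p - 1)" "0 < m" "m \<le> u"
  shows "G powr (-(p-1)) * M powr (-p) * m powr p
     \<le> (G * t powr q) powr (-1/(q-1)) * u powr p * r powr (p\<^sup>2 - p)"
proof -
  have e: "-1/(q-1) = -(p-1)"
    using exponent_eqs(1) q_gt_1 by (auto simp: field_simps)
  have "(G * (M * r powr (p-1)) powr q) powr (-(p-1)) \<le> (G * t powr q) powr (-(p-1))"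
    using assms p_gt_1 q_gt_1 by (intro powr_mono2' mult_left_mono powr_mono2) auto
  moreover have "(G * (M * r powr (p-1)) powr q) powr (-(p-1))
      = G powr (-(p-1)) * M powr (-((p-1) * q)) * r powr (-((p-1) * q * (p-1)))"
  proof -
    have "(G * (M * r powr k) powr q) powr (- k) = G powr (- k) * M powr (-(k * q)) * r powr (-(k * q * k))" for k
      using assms by (simp add: powr_mult powr_powr mult_ac)
    then show ?thesis .
  qed
  ultimately have "G powr (-(p-1)) * M powr (-p) * r powr (-(p\<^sup>2 - p)) \<le> (G * t powr q) powr (-1/(q-1))"
    unfolding e exponent_eqs by (simp add: power2_eq_square algebra_simps)
  then have "(G powr (-(p-1)) * M powr (-p) * r powr (-(p\<^sup>2 - p))) * m powr p * r powr (p\<^sup>2 - p)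
      \<le> (G * t powr q) powr (-1/(q-1)) * u powr p * r powr (p\<^sup>2 - p)"
    using assms p_gt_1 by (intro mult_right_mono mult_mono powr_mono2) auto
  moreover have "r powr (-(p\<^sup>2 - p)) * r powr (p\<^sup>2 - p) = 1"
    using assms by (simp flip: powr_add)
  ultimately show ?thesis by (simp add: mult_ac)
qed

text \<open>
  If \<open>E\<close> is \<open>F z - y\<close> minus the linearization error, then \<open>A (z - a) = E - (F a - y)\<close>. Hence the
  gradient direction pairs with \<open>z - a\<close> to at most \<open>- r powr (p - 1) * (r - \<eta> - e)\<close>, where \<open>e\<close>
  bounds the norm of the linearization error. The linearization error is quadratic in \<open>z - a\<close>; the lower
  bound on the Bregman distance turns it into the term with \<open>w\<close>, and conditional stability bounds it
  by \<open>K (r + \<eta>)\<^sup>2 = r - \<eta> - u\<close>. So the pairing is at most \<open>- r powr (p - 1) * u\<close>, and the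
  remainder of the dual step, scaled by the choice of \<open>\<mu>\<close>, consumes only the fraction \<open>1 / q\<close> of this
  gain. The fraction \<open>1 / p\<close> remains.
\<close>

lemma steepest_descent_step:
  fixes F :: "'a \<Rightarrow> 'b::real_normed_vector" and A :: "'a \<Rightarrow>\<^sub>L 'b" and a z :: 'a and y :: 'b
  assumes G: "0 < G" "\<And>f g :: 'a \<Rightarrow>\<^sub>L real. bregman_dual q f g \<le> G / q * norm (f - g) powr q"
    and j: "j \<in> duality_mapping p (F a - y)"
    and lin: "norm (F z - F a - blinfun_apply A (z - a)) \<le> L/2 * (norm (z - a))\<^sup>2"
    and stab: "bregman p a z \<le> C powr p * norm (F a - F z) powr p"
    and pos: "0 < L" "0 < C"
    and res: "norm (F z - y) \<le> \<eta>"
    and K: "K = 1/2 * c powr (-2/p) * L * C\<^sup>2"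
    and T: "T = blinfun_apply (dual_operator A) j"
    and r: "r = norm (F a - y)" "0 < r"
    and u: "u = - K * r\<^sup>2 + (1 - 2 * K * \<eta>) * r - \<eta> - K * \<eta>\<^sup>2" "0 < u"
    and t': "t' = G * norm T powr q"
    and v: "v = t' powr (-1/(q-1)) * u powr (1/(q-1)) * r powr (p\<^sup>2 - p) * (r - \<eta>)
        - 1/q * t' powr (-1/(q-1)) * u powr p * r powr (p\<^sup>2 - p)"
    and w: "w = L/2 * c powr (-2/p) * t' powr (-1/(q-1)) * u powr (1/(q-1)) * r powr (p\<^sup>2 - p)"
    and \<mu>: "\<mu> = t' powr (-1/(q-1)) * u powr (1/(q-1)) * r powr ((p-1)/(q-1))"
  shows "0 < norm T"
    and "bregman p (J_dual q (J p a - \<mu> *\<^sub>R T)) z \<le> bregman p a z + w * bregman p a z powr (2/p) - v"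
    and "w * bregman p a z powr (2/p) - v \<le> - (1/p) * (t' powr (-1/(q-1)) * u powr p * r powr (p\<^sup>2 - p))"
proof -
  define e where "e = L/2 * c powr (-2/p) * bregman p a z powr (2/p)"
  have lin_e: "norm (F z - F a - blinfun_apply A (z - a)) \<le> e"
  proof -
    have "L/2 * (norm (z - a))\<^sup>2 \<le> L/2 * (c powr (-2/p) * bregman p a z powr (2/p))"
      using norm_diff_sq_le_bregman[of a z] pos by (intro mult_left_mono) (auto simp: norm_minus_commute)
    then show ?thesis using lin by (simp add: e_def)
  qed
  have \<eta>_nonneg: "0 \<le> \<eta>" using res norm_ge_zero order_trans by blast
  have "norm (F a - F z) \<le> r + \<eta>"
    using norm_triangle_ineq4[of "F a - y" "F z - y"] res r by simp
  then have "(norm (F a - F z)) powr p \<le> (r + \<eta>) powr p"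
    using p_gt_1 by (intro powr_mono2) auto
  then have "bregman p a z \<le> C powr p * (r + \<eta>) powr p"
    using stab pos by (smt (verit) mult_left_mono powr_ge_zero)
  then have "bregman p a z powr (2/p) \<le> (C powr p * (r + \<eta>) powr p) powr (2/p)"
    using p_gt_1 bregman_nonneg by (intro powr_mono2) auto
  also have "\<dots> = C\<^sup>2 * (r + \<eta>)\<^sup>2"
    using p_gt_1 pos r \<eta>_nonneg by (simp add: powr_mult powr_powr)
  finally have "e \<le> L/2 * c powr (-2/p) * (C\<^sup>2 * (r + \<eta>)\<^sup>2)"
    unfolding e_def using pos by (intro mult_left_mono) auto
  also have "\<dots> = K * (r + \<eta>)\<^sup>2" by (simp add: K)
  also have "\<dots> = r - \<eta> - u" by (simp add: u power2_eq_square algebra_simps)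
  finally have e_u: "u \<le> r - \<eta> - e" by simp
  have T_le: "blinfun_apply T (z - a) \<le> - (r powr (p - 1) * (r - \<eta> - e))"
  proof -
    have nj: "norm j = r powr (p - 1)" and jR: "blinfun_apply j (F a - y) = r * r powr (p - 1)"
      using j r by (auto simp: duality_mapping_def)
    define E where "E = (F z - y) - (F z - F a - blinfun_apply A (z - a))"
    have "blinfun_apply A (z - a) = E - (F a - y)" by (simp add: E_def)
    moreover have "blinfun_apply T (z - a) = blinfun_apply j (blinfun_apply A (z - a))"
      by (simp add: T dual_operator.rep_eq)
    ultimately have "blinfun_apply T (z - a) = blinfun_apply j E - r * r powr (p - 1)"
      by (simp only: blinfun.diff_right[of j E] jR)
    also have "blinfun_apply j E \<le> norm j * norm E"
      using norm_blinfun[of j E] by simp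
    also have "\<dots> \<le> r powr (p - 1) * (\<eta> + e)"
      unfolding nj E_def using norm_triangle_ineq4[of "F z - y"] res lin_e
      by (intro mult_left_mono) (smt (verit), simp)
    finally show ?thesis by (simp add: algebra_simps)
  qed
  have "0 < r powr (p - 1) * (r - \<eta> - e)" using r e_u u(2) by simp
  then have "T \<noteq> 0" using T_le by auto
  then show t: "0 < norm T" by simp
  define A' where "A' = t' powr (-1/(q-1))"
  define W where "W = A' * u powr (1/(q-1)) * r powr (p\<^sup>2 - p)"
  note powers = step_size_powers[OF G(1) t u(2) r(2), folded t', folded A'_def]
  have A'_pos: "0 < A'" using t G by (simp add: A'_def t')
  have \<mu>_pos: "0 < \<mu>" unfolding \<mu> A'_def[symmetric] using A'_pos u(2) r(2) by simp
  have \<mu>_W: "\<mu> * r powr (p - 1) = W" unfolding \<mu> W_def A'_def[symmetric] by (rule powers)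
  have Wu: "A' * u powr p * r powr (p\<^sup>2 - p) = W * u" by (simp add: W_def flip: powers(3))
  have quad: "G/q * (\<mu> * norm T) powr q = 1/q * (W * u)"
    unfolding \<mu> A'_def[symmetric] powers(2) Wu[symmetric] by simp
  have we: "w * bregman p a z powr (2/p) = W * e" by (simp add: w W_def A'_def e_def)
  have vW: "v = W * (r - \<eta>) - 1/q * (W * u)"
    unfolding Wu[symmetric] by (simp add: v W_def A'_def)
  have "bregman p (J_dual q (J p a - \<mu> *\<^sub>R T)) z
      \<le> bregman p a z + G/q * (\<mu> * norm T) powr q + \<mu> * blinfun_apply T (z - a)"
    using bregman_dual_step[of a "\<mu> *\<^sub>R T" z] G(2)[of "J p a" "J p a - \<mu> *\<^sub>R T"] \<mu>_pos
    by (simp add: blinfun.scaleR_left)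
  also have "\<mu> * blinfun_apply T (z - a) \<le> \<mu> * - (r powr (p - 1) * (r - \<eta> - e))"
    using T_le \<mu>_pos by (intro mult_left_mono) auto
  also have "\<mu> * - (r powr (p - 1) * (r - \<eta> - e)) = - (W * (r - \<eta> - e))"
    by (simp flip: \<mu>_W)
  finally show "bregman p (J_dual q (J p a - \<mu> *\<^sub>R T)) z \<le> bregman p a z + w * bregman p a z powr (2/p) - v"
    unfolding quad we vW by (simp add: algebra_simps)
  have "W * u \<le> W * (r - \<eta> - e)"
    using e_u A'_pos by (intro mult_left_mono) (auto simp: W_def)
  moreover have "1/p * (W * u) = W * u - 1/q * (W * u)"
  proof -
    have "1/p = 1 - 1/q" using conj_exponents by simp
    then show ?thesis by (simp only: left_diff_distrib mult_1)
  qed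
  ultimately have "W * e - v \<le> - (1/p * (W * u))"
    unfolding vW by (simp add: algebra_simps)
  then show "w * bregman p a z powr (2/p) - v \<le> - (1/p) * (t' powr (-1/(q-1)) * u powr p * r powr (p\<^sup>2 - p))"
    unfolding we A'_def[symmetric] Wu by simp
qed

end

section \<open>Convergence of the algorithm\<close>

theorem theorem3p3:
  fixes p q :: real
    and F :: "'a::banach \<Rightarrow> 'b::banach" and D Z B :: "'a set"
    and DF :: "'a \<Rightarrow> ('a \<Rightarrow>\<^sub>L 'b)"
    and j\<^sub>p :: "'b \<Rightarrow> ('b \<Rightarrow>\<^sub>L real)"
    and y :: 'b and z x\<^sub>0 :: 'a
    and C\<^sub>p G\<^sub>q L L' C C' \<eta> \<eta>' \<rho> :: real
    and x x' :: "nat \<Rightarrow> 'a" and R :: "nat \<Rightarrow> 'b" and T :: "nat \<Rightarrow> ('a \<Rightarrow>\<^sub>L real)"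
    and r t t' u v w \<mu> :: "nat \<Rightarrow> real"
  assumes "1 < p" and "1 < q" and "1/p + 1/q = 1"
    and "p_convex TYPE('a) p" and "q_smooth TYPE('a) q"
    and "C\<^sub>p > 0" and "\<And>a b :: 'a. bregman p a b \<ge> C\<^sub>p / p * norm (a - b) powr p"
    and "G\<^sub>q > 0"
    and "\<And>f g :: 'a \<Rightarrow>\<^sub>L real. bregman_dual q f g \<le> G\<^sub>q / q * norm (f - g) powr q"
    and "\<And>b. j\<^sub>p b \<in> duality_mapping p b"
    and "continuous_on D F"
    and "\<And>a. a \<in> D \<Longrightarrow> (F has_derivative blinfun_apply (DF a)) (at a within D)"
    and "Z \<subseteq> D" and "closed Z" and "convex Z"
    and "z \<in> Z" and "norm (F z - y) = infdist y (F ` Z)"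
    and "L > 0" and "L' > 0" and "C > 0"
    and C': "C' = 1/2 * (C\<^sub>p / p) powr (-2/p) * L * C^2"
    and "infdist y (F ` Z) \<le> \<eta>" and "0 < \<eta>" and "\<eta> < 1 / (8 * C')"
    and "\<eta>' > 3 * \<eta>"
    and \<rho>: "\<rho> = C\<^sub>p / p * (2 * C' * L') powr (-p) * (1 + sqrt (1 - 8 * C' * \<eta>) - 4 * \<eta> * C') powr p"
    and B: "B = {a. bregman p a z \<le> \<rho>}" and "B \<subseteq> D"
    and "\<And>a. a \<in> B \<Longrightarrow> norm (DF a) \<le> L'"
    and "\<And>a b. a \<in> B \<Longrightarrow> b \<in> B \<Longrightarrow> norm (DF a - DF b) \<le> L * norm (a - b)"
    and "weakly_seq_closed_on D F"
    and "\<And>a b. a \<in> B \<inter> Z \<Longrightarrow> b \<in> B \<inter> Z \<Longrightarrow> bregman p a b \<le> C powr p * norm (F a - F b) powr p"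
    and "x\<^sub>0 \<in> Z" and "bregman p x\<^sub>0 z < \<rho>"
    and R: "\<And>k. R k = F (x k) - y"
    and T: "\<And>k. T k = blinfun_apply (dual_operator (DF (x k))) (j\<^sub>p (F (x k) - y))"
    and r: "\<And>k. r k = norm (R k)"
    and t: "\<And>k. t k = norm (T k)"
    and t': "\<And>k. t' k = G\<^sub>q * t k powr q"
    and u: "\<And>k. u k = - C' * (r k)^2 + (1 - 2 * C' * \<eta>) * r k - \<eta> - C' * \<eta>^2"
    and v: "\<And>k. v k =
        t' k powr (-1/(q-1)) * u k powr (1/(q-1)) * r k powr (p^2 - p) * (r k - \<eta>)
        - 1/q * t' k powr (-1/(q-1)) * u k powr p * r k powr (p^2 - p)"
    and w: "\<And>k. w k =
        L/2 * (C\<^sub>p / p) powr (-2/p) * t' k powr (-1/(q-1)) * u k powr (1/(q-1)) * r k powr (p^2 - p)"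
    and \<mu>: "\<And>k. \<mu> k = t' k powr (-1/(q-1)) * u k powr (1/(q-1)) * r k powr ((p-1)/(q-1))"
    and "x 0 = x\<^sub>0"
    and "\<And>k. \<not> r k \<le> \<eta>' \<Longrightarrow> x' (Suc k) = J_dual q (J p (x k) - \<mu> k *\<^sub>R T k)"
    and "\<And>k. \<not> r k \<le> \<eta>' \<Longrightarrow> x (Suc k) = bregman_proj p Z (x' (Suc k))"
  shows "\<exists>K. K = (LEAST k. norm (F (x k) - y) \<le> \<eta>') \<and> norm (F (x K) - y) \<le> \<eta>' \<and>
    (\<forall>k<K. bregman p (x (Suc k)) z
              \<le> bregman p (x k) z + w k * bregman p (x k) z powr (2/p) - v k
         \<and> w k * bregman p (x k) z powr (2/p) - v k < 0)"
proof -
  note G_pos = assms(8)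
    and bregman_dual_le = assms(9)
    and j_duality = assms(10)
    and F_deriv = assms(12)
    and Z_closed = assms(14)
    and Z_convex = assms(15)
    and z_in_Z = assms(16)
    and L_pos = assms(18)
    and L'_pos = assms(19)
    and C_pos = assms(20)
    and \<eta>_pos = assms(23)
    and \<eta>_less = assms(24)
    and \<eta>'_gt = assms(25)
    and B_subset = assms(28)
    and DF_bound = assms(29)
    and DF_lipschitz = assms(30)
    and stability = assms(32)
    and x0_in_Z = assms(33)
    and x0_close = assms(34)
    and x_0 = assms(44)
    and x'_Suc = assms(45)
    and x_Suc = assms(46)
  define c where "c = C\<^sub>p / p"
  interpret bregman_space p q c "TYPE('a)"
    using assms(1-7) by unfold_locales (auto simp: c_def norm_minus_commute)
  define \<Delta> where "\<Delta> k = bregman p (x k) z" for k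
  define S where "S = sqrt (1 - 8 * C' * \<eta>)"
  have C'_pos: "0 < C'" unfolding C' using L_pos C_pos c_pos by (simp flip: c_def)
  have small: "8 * C' * \<eta> < 1" using \<eta>_less C'_pos by (simp add: field_simps)
  have res: "norm (F z - y) \<le> \<eta>" using assms(17,22) by simp
  have S_nonneg: "0 \<le> S" using small by (simp add: S_def)
  define \<sigma> where "\<sigma> = L' * (\<Delta> 0 / c) powr (1/p) + 2 * \<eta>"
  \<comment> \<open>A bound for every \<open>r k + \<eta>\<close>: the radius \<open>\<rho>\<close> is such that its counterpart for \<open>\<rho>\<close>\<close>
  \<comment> \<open>instead of \<open>\<Delta> 0\<close> is the larger root of the quadratic that defines \<open>u\<close>.\<close>
  have \<sigma>_less: "\<sigma> < (1 + S) / (2 * C')"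
  proof -
    define g where "g = 1 + S - 4 * \<eta> * C'"
    have "4 * \<eta> * C' = 8 * C' * \<eta> / 2" by simp
    then have g: "0 < g" using small S_nonneg unfolding g_def by linarith
    have "\<Delta> 0 / c < ((2 * C' * L') powr - p * g powr p)"
      using x0_close x_0 \<rho> c_pos
      by (simp add: \<Delta>_def g_def S_def c_def[symmetric] divide_less_eq mult_ac)
    also have "\<dots> = (g / (2 * C' * L')) powr p"
      using g C'_pos L'_pos by (simp add: powr_divide powr_minus_divide)
    finally have "(\<Delta> 0 / c) powr (1/p) < ((g / (2 * C' * L')) powr p) powr (1/p)"
      using p_gt_1 c_pos bregman_nonneg by (intro powr_less_mono2) (auto simp: \<Delta>_def)
    also have "\<dots> = g / (2 * C' * L')"
      using p_gt_1 g C'_pos L'_pos by (simp add: powr_powr)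
    finally have "L' * (\<Delta> 0 / c) powr (1/p) < L' * (g / (2 * C' * L'))"
      using L'_pos by (intro mult_strict_left_mono)
    also have "\<dots> = (1 + S) / (2 * C') - 2 * \<eta>"
      using C'_pos L'_pos by (simp add: g_def field_simps)
    finally show ?thesis by (simp add: \<sigma>_def)
  qed
  obtain m where m: "0 < m" "\<And>s. 4 * \<eta> \<le> s \<Longrightarrow> s \<le> \<sigma> \<Longrightarrow> m \<le> s - 2 * \<eta> - C' * s\<^sup>2"
    using discrepancy_quadratic_lower_bound[OF C'_pos \<eta>_pos small \<sigma>_less[unfolded S_def]] by blast
  define \<delta> where "\<delta> = 1/p * (G\<^sub>q powr (-(p-1)) * L' powr (-p) * m powr p)"
  have \<delta>_pos: "0 < \<delta>" using p_gt_1 G_pos L'_pos m(1) by (simp add: \<delta>_def)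

  \<comment> \<open>The decrease \<open>\<delta>\<close> is the same for all \<open>k\<close>, which forces the algorithm to stop.\<close>
  have step: "x (Suc k) \<in> Z \<and> \<Delta> (Suc k) \<le> \<Delta> k + w k * \<Delta> k powr (2/p) - v k
      \<and> w k * \<Delta> k powr (2/p) - v k \<le> - \<delta>"
    if xk: "x k \<in> Z" "\<Delta> k \<le> \<Delta> 0" "\<not> r k \<le> \<eta>'" for k
  proof -
    let ?seg = "closed_segment (x k) z"
    have "\<Delta> k < \<rho>" using xk(2) x0_close x_0 by (simp add: \<Delta>_def)
    then have seg_B: "?seg \<subseteq> B"
      using segment_in_bregman_ball[of _ "x k" z] unfolding B \<Delta>_def by fastforce
    then have ends: "x k \<in> B \<inter> Z" "z \<in> B \<inter> Z" using xk z_in_Z by auto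
    have der: "(F has_derivative blinfun_apply (DF a)) (at a within ?seg)" if "a \<in> ?seg" for a
    proof (rule has_derivative_subset[OF F_deriv])
      show "a \<in> D" "?seg \<subseteq> D" using that seg_B B_subset by blast+
    qed
    have lin: "norm (F z - F (x k) - blinfun_apply (DF (x k)) (z - x k)) \<le> L/2 * (norm (z - x k))\<^sup>2"
      using seg_B ends by (intro linearization_error_segment der DF_lipschitz) auto
    have "norm (F (x k) - F z) \<le> L' * norm (x k - z)"
      using seg_B DF_bound
      by (intro differentiable_bound[OF convex_closed_segment der])
        (auto simp flip: norm_blinfun.rep_eq)
    also have "\<dots> \<le> L' * (\<Delta> 0 / c) powr (1/p)"
    proof -
      have "norm (x k - z) \<le> (\<Delta> k / c) powr (1/p)"
        unfolding \<Delta>_def by (rule norm_diff_le_bregman)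
      also have "\<dots> \<le> (\<Delta> 0 / c) powr (1/p)"
        using xk(2) c_pos p_gt_1 bregman_nonneg
        by (intro powr_mono2 divide_right_mono) (auto simp: \<Delta>_def)
      finally show ?thesis using L'_pos by (intro mult_left_mono) auto
    qed
    finally have "norm (F (x k) - F z) + 2 * \<eta> \<le> \<sigma>" by (simp add: \<sigma>_def)
    moreover have "r k \<le> norm (F (x k) - F z) + norm (F z - y)"
      unfolding r R using norm_triangle_ineq[of "F (x k) - F z" "F z - y"] by simp
    ultimately have "r k + \<eta> \<le> \<sigma>" using res by simp
    moreover have "4 * \<eta> \<le> r k + \<eta>" using xk(3) \<eta>'_gt by simp
    ultimately have "m \<le> (r k + \<eta>) - 2 * \<eta> - C' * (r k + \<eta>)\<^sup>2" by (intro m(2))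
    also have "\<dots> = u k" by (simp add: u power2_eq_square algebra_simps)
    finally have u_ge: "m \<le> u k" .
    have r_pos: "0 < r k" using xk(3) \<eta>_pos \<eta>'_gt by simp
    have stab: "bregman p (x k) z \<le> C powr p * norm (F (x k) - F z) powr p"
      by (rule stability[OF ends])
    note ds = steepest_descent_step[OF G_pos bregman_dual_le j_duality lin stab L_pos C_pos res
        C'[folded c_def] T[of k] r[of k, unfolded R] r_pos u[of k] less_le_trans[OF m(1) u_ge]
        t'[of k, unfolded t] v[of k] w[of k, folded c_def] \<mu>[of k], folded t, folded \<Delta>_def]
    have t_le: "t k \<le> L' * r k powr (p - 1)"
    proof -
      have "norm (j\<^sub>p (F (x k) - y)) = r k powr (p - 1)"
        using j_duality[of "F (x k) - y"] by (simp add: duality_mapping_def r R)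
      then have "t k \<le> r k powr (p - 1) * norm (DF (x k))"
        unfolding t T dual_operator.rep_eq using norm_blinfun_compose by metis
      also have "\<dots> \<le> r k powr (p - 1) * L'"
        using DF_bound ends by (intro mult_left_mono) auto
      finally show ?thesis by (simp add: mult.commute)
    qed
    have gain: "\<delta> \<le> 1/p * (t' k powr (-1/(q-1)) * u k powr p * r k powr (p\<^sup>2 - p))"
      unfolding \<delta>_def t' using p_gt_1
      by (intro mult_left_mono step_gain_lower_bound[OF G_pos ds(1) r_pos L'_pos t_le m(1) u_ge]) auto
    have x': "x' (Suc k) = J_dual q (J p (x k) - \<mu> k *\<^sub>R T k)" using x'_Suc xk(3) by simp
    have xS: "x (Suc k) = bregman_proj p Z (x' (Suc k))" using x_Suc xk(3) by simp
    have "\<Delta> (Suc k) \<le> bregman p (x' (Suc k)) z"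
      unfolding \<Delta>_def xS by (rule bregman_proj_le[OF Z_closed Z_convex z_in_Z])
    also have "\<dots> \<le> \<Delta> k + w k * \<Delta> k powr (2/p) - v k"
      unfolding x' by (rule ds(2))
    finally have "\<Delta> (Suc k) \<le> \<Delta> k + w k * \<Delta> k powr (2/p) - v k" .
    moreover have "x (Suc k) \<in> Z" unfolding xS by (rule bregman_proj_mem[OF Z_closed Z_convex z_in_Z])
    moreover have "w k * \<Delta> k powr (2/p) - v k \<le> - \<delta>" using ds(3) gain by simp
    ultimately show ?thesis by blast
  qed

  have inv: "x k \<in> Z \<and> \<Delta> k \<le> \<Delta> 0 - real k * \<delta>" if "\<And>i. i < k \<Longrightarrow> \<not> r i \<le> \<eta>'" for k
    using that
  proof (induction k)
    case 0
    then show ?case using x0_in_Z x_0 by simp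
  next
    case (Suc k)
    then have IH: "x k \<in> Z" "\<Delta> k \<le> \<Delta> 0 - real k * \<delta>" by auto
    moreover have "0 \<le> real k * \<delta>" using \<delta>_pos by simp
    ultimately have "\<Delta> k \<le> \<Delta> 0" by simp
    from step[OF IH(1) this Suc.prems[of k]] IH(2) show ?case by (simp add: algebra_simps)
  qed

  have stops: "\<exists>k. r k \<le> \<eta>'"
  proof (rule ccontr)
    assume "\<not> ?thesis"
    then have "\<Delta> k \<le> \<Delta> 0 - real k * \<delta>" for k using inv[of k] by simp
    moreover obtain k where "\<Delta> 0 < real k * \<delta>" using reals_Archimedean3[OF \<delta>_pos] by blast
    moreover have "0 \<le> \<Delta> k" by (simp add: \<Delta>_def bregman_nonneg)
    ultimately show False by (smt (verit))
  qed
  define N where "N = (LEAST k. r k \<le> \<eta>')"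
  have N: "r N \<le> \<eta>'" unfolding N_def using stops by (rule LeastI_ex)
  have before: "\<not> r k \<le> \<eta>'" if "k < N" for k using that not_less_Least unfolding N_def by blast
  have "\<Delta> (Suc k) \<le> \<Delta> k + w k * \<Delta> k powr (2/p) - v k \<and> w k * \<Delta> k powr (2/p) - v k < 0"
    if k: "k < N" for k
  proof -
    have "x k \<in> Z" "\<Delta> k \<le> \<Delta> 0 - real k * \<delta>" using inv[of k] before k by auto
    moreover have "0 \<le> real k * \<delta>" using \<delta>_pos by simp
    ultimately have "x k \<in> Z" "\<Delta> k \<le> \<Delta> 0" by simp_all
    from step[OF this before[OF k]] show ?thesis using \<delta>_pos by linarith
  qed
  with N show ?thesis
    by (intro exI[of _ N]) (auto simp: N_def \<Delta>_def r R)
qed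

end
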